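(* Let $\nu,\tau>0$. Under the solvability condition $(P^{n+1},1)_h=0$, both of the following fully discrete BDF schemes are uniquely solvable; that is, at each time step, given the previously computed velocities, there is exactly one pair $(\bm U^{n+1},P^{n+1})\in[V_{ew};V_{ns}]\times V_c$ with $(P^{n+1},1)_h=0$ satisfying the scheme. BDF1: given $\bm U^0\in[V_{ew};V_{ns}]$, for $0\le n\le N_t-1$, $$\frac{\bm U^{n+1}-\bm U^n}{\tau}-\nu\Delta_h\bm U^{n+1}+\bm B(\bm U^n,\bm U^{n+1})+\nabla_DP^{n+1}=\mathscr F^{n+1},\qquad \nabla_d\cdot\bm U^{n+1}=\bm 0 .$$ BDF2: given $\bm U^0\in[V_{ew};V_{ns}]$, and $\bm U^1$ obtained from the BDF1 scheme, for $1\le n\le N_t-1$, $$\frac{3\bm U^{n+1}-4\bm U^n+\bm U^{n-1}}{2\tau}-\nu\Delta_h\bm U^{n+1}+\bm B(\overline{\bm U}^{n+1},\bm U^{n+1})+\nabla_DP^{n+1}=\mathscr F^{n+1},\qquad \nabla_d\cdot\bm U^{n+1}=\bm 0,$$ with $\overline{\bm U}^{n+1}=2\bm U^n-\bm U^{n-1}$.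
   Context: Setting: two space dimensions with periodic boundary conditions on $[0,L_x]\times[0,L_y]$; $N_x,N_y,N_t$ are positive integers, $h_x=L_x/N_x$, $h_y=L_y/N_y$, $T>0$, $\tau=T/N_t$. $V_{ew},V_{ns},V_c$ are the spaces of real grid functions on, respectively, the points $(x_{i+1/2},y_j)$ ($0\le i\le N_x-1$, $1\le j\le N_y$), $(x_i,y_{j+1/2})$ ($1\le i\le N_x$, $0\le j\le N_y-1$), $(x_i,y_j)$ ($1\le i\le N_x$, $1\le j\le N_y$), where $x_l=(l-\frac12)h_x$, $y_l=(l-\frac12)h_y$; each is identified with the real $N_x\times N_y$ matrices. $[V_{ew};V_{ns}]$ is the space of pairs $\bm U=[U;V]$ with $U\in V_{ew}$, $V\in V_{ns}$. For matrices of equal size, $(A,B)_h=h_xh_y\mathrm{Tr}(A^TB)$, $\|A\|_h=\sqrt{(A,A)_h}$; for pairs, the inner products of the components are summed. In $(P,1)_h$, $1$ is the all-ones grid function. Differentiation matrices ($N\times N$, acting on $w\in\mathbb R^N$ with indices modulo $N$): $(\mathbb C(N)w)_i=\frac12(w_i+w_{i+1})$, $(\mathbb D_1(N,h)w)_i=\frac{1}{2h}(w_{i+1}-w_{i-1})$, $(\mathbb D_2(N,h)w)_i=\frac1h(w_{i+1}-w_i)$, $(\mathbb D_3(N,h)w)_i=\frac1{h^2}(w_{i+1}-2w_i+w_{i-1})$. Put $\mathbb A_1=\mathbb C(N_x)$, $\mathbb A_2=\mathbb D_1(N_x,h_x)$, $\mathbb A_3=\mathbb D_2(N_x,h_x)$,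 $\mathbb A_4=\mathbb D_3(N_x,h_x)$, and $\mathbb B_1=\mathbb C(N_y)$, $\mathbb B_2=\mathbb D_1(N_y,h_y)$, $\mathbb B_3=\mathbb D_2(N_y,h_y)$, $\mathbb B_4=\mathbb D_3(N_y,h_y)$. Discrete operators: $\nabla_d\cdot\bm U=\mathbb A_3U+V\mathbb B_3^T\in V_c$; $\nabla_DP=[-\mathbb A_3^TP;\,-P\mathbb B_3]\in[V_{ew};V_{ns}]$; $\Delta_hW=\mathbb A_4W+W\mathbb B_4^T$, applied componentwise to pairs. $\bm F:[V_{ew};V_{ns}]\to[V_{ew};V_{ns}]$ is a given map with $(\bm F(\bm U),\bm U)_h\ne0$ whenever $\|\bm U\|_h\neq0$. $\bm G(\bm U)=[G_1(\bm U);G_2(\bm U)]$ is $\bm 0$ if $\|\bm U\|_h=0$, and otherwise $$G_1(\bm U)=\frac{U\odot(\mathbb A_2U)-\big((\mathbb A_1^TV)\odot(U\mathbb B_3)\big)\mathbb B_1^T}{(\bm F(\bm U),\bm U)_h},\qquad G_2(\bm U)=\frac{V\odot(V\mathbb B_2^T)-\mathbb A_1\big((\mathbb A_3^TV)\odot(U\mathbb B_1)\big)}{(\bm F(\bm U),\bm U)_h},$$ with $\odot$ the Hadamard (entrywise) product. For $\bm U,\bm W\in[V_{ew};V_{ns}]$, $$\bm B(\bm U,\bm W)=\big(\bm F(\bm U),\bm W\big)_h\bm G(\bm U)-\big(\bm G(\bm U),\bm W\big)_h\bm F(\bm U).$$ $\mathscr F^{n+1}\in[V_{ew};V_{ns}]$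 is the given spatial discretization of the external force. *)

theory Defs
  imports "HOL-Library.Product_Plus" "HOL-Library.FuncSet" "Jordan_Normal_Form.Matrix"
begin

text \<open>Indices are shifted to start at 0. Row \<open>i\<close>, column \<open>j\<close> (\<open>i < Nx\<close>, \<open>j < Ny\<close>) of a matrix
  stands for the value at \<open>(x\<^sub>i\<^sub>+\<^sub>1\<^sub>/\<^sub>2, y\<^sub>j\<^sub>+\<^sub>1)\<close> in \<open>V\<^sub>e\<^sub>w\<close>, at \<open>(x\<^sub>i\<^sub>+\<^sub>1, y\<^sub>j\<^sub>+\<^sub>1\<^sub>/\<^sub>2)\<close> in \<open>V\<^sub>n\<^sub>s\<close>,
  and at \<open>(x\<^sub>i\<^sub>+\<^sub>1, y\<^sub>j\<^sub>+\<^sub>1)\<close> in \<open>V\<^sub>c\<close>; all three spaces are thereby the same set of matrices.\<close>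

type_synonym gfun = "real mat"
type_synonym vfield = "gfun \<times> gfun"

abbreviation (input) V_ew :: "nat \<Rightarrow> nat \<Rightarrow> gfun set" where "V_ew Nx Ny \<equiv> carrier_mat Nx Ny"
abbreviation (input) V_ns :: "nat \<Rightarrow> nat \<Rightarrow> gfun set" where "V_ns Nx Ny \<equiv> carrier_mat Nx Ny"
abbreviation (input) V_c :: "nat \<Rightarrow> nat \<Rightarrow> gfun set" where "V_c Nx Ny \<equiv> carrier_mat Nx Ny"
abbreviation (input) Vel :: "nat \<Rightarrow> nat \<Rightarrow> vfield set" where "Vel Nx Ny \<equiv> V_ew Nx Ny \<times> V_ns Nx Ny"

definition smult_vf :: "real \<Rightarrow> vfield \<Rightarrow> vfield" (infixr \<open>\<cdot>\<^sub>p\<close> 70) where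
  "c \<cdot>\<^sub>p U = (c \<cdot>\<^sub>m fst U, c \<cdot>\<^sub>m snd U)"

definition zero_vf :: "nat \<Rightarrow> nat \<Rightarrow> vfield" where
  "zero_vf Nx Ny = (0\<^sub>m Nx Ny, 0\<^sub>m Nx Ny)"

definition trace_mat :: "real mat \<Rightarrow> real" where
  "trace_mat A = (\<Sum>i<dim_row A. A $$ (i, i))"

definition hadamard :: "real mat \<Rightarrow> real mat \<Rightarrow> real mat" (infixl \<open>\<odot>\<close> 70) where
  "A \<odot> B = mat (dim_row A) (dim_col A) (\<lambda>(i, j). A $$ (i, j) * B $$ (i, j))"

definition ones_mat :: "nat \<Rightarrow> nat \<Rightarrow> real mat" where
  "ones_mat Nx Ny = mat Nx Ny (\<lambda>_. 1)"

definition inner_h :: "real \<Rightarrow> real \<Rightarrow> gfun \<Rightarrow> gfun \<Rightarrow> real" where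
  "inner_h hx hy A B = hx * hy * trace_mat (transpose_mat A * B)"

definition vinner_h :: "real \<Rightarrow> real \<Rightarrow> vfield \<Rightarrow> vfield \<Rightarrow> real" where
  "vinner_h hx hy U W = inner_h hx hy (fst U) (fst W) + inner_h hx hy (snd U) (snd W)"

definition vnorm_h :: "real \<Rightarrow> real \<Rightarrow> vfield \<Rightarrow> real" where
  "vnorm_h hx hy U = sqrt (vinner_h hx hy U U)"

text \<open>\<open>shift_mat N k\<close> is the periodic shift \<open>(S w)\<^sub>i = w\<^sub>i\<^sub>+\<^sub>k\<close>. The differentiation matrices are linear
  combinations of shifts, so that coinciding entries add up when \<open>N \<le> 2\<close>.\<close>

definition shift_mat :: "nat \<Rightarrow> int \<Rightarrow> real mat" where
  "shift_mat N k = mat N N (\<lambda>(i, j). of_bool (int j = (int i + k) mod int N))"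

definition C_mat :: "nat \<Rightarrow> real mat" where
  "C_mat N = (1 / 2) \<cdot>\<^sub>m (1\<^sub>m N + shift_mat N 1)"

definition D1_mat :: "nat \<Rightarrow> real \<Rightarrow> real mat" where
  "D1_mat N h = (1 / (2 * h)) \<cdot>\<^sub>m (shift_mat N 1 - shift_mat N (-1))"

definition D2_mat :: "nat \<Rightarrow> real \<Rightarrow> real mat" where
  "D2_mat N h = (1 / h) \<cdot>\<^sub>m (shift_mat N 1 - 1\<^sub>m N)"

definition D3_mat :: "nat \<Rightarrow> real \<Rightarrow> real mat" where
  "D3_mat N h = (1 / h\<^sup>2) \<cdot>\<^sub>m (shift_mat N 1 - 2 \<cdot>\<^sub>m 1\<^sub>m N + shift_mat N (-1))"

definition div_d :: "nat \<Rightarrow> nat \<Rightarrow> real \<Rightarrow> real \<Rightarrow> vfield \<Rightarrow> gfun" where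
  "div_d Nx Ny hx hy U = D2_mat Nx hx * fst U + snd U * transpose_mat (D2_mat Ny hy)"

definition grad_D :: "nat \<Rightarrow> nat \<Rightarrow> real \<Rightarrow> real \<Rightarrow> gfun \<Rightarrow> vfield" where
  "grad_D Nx Ny hx hy P = (- (transpose_mat (D2_mat Nx hx) * P), - (P * D2_mat Ny hy))"

definition lap_h :: "nat \<Rightarrow> nat \<Rightarrow> real \<Rightarrow> real \<Rightarrow> gfun \<Rightarrow> gfun" where
  "lap_h Nx Ny hx hy W = D3_mat Nx hx * W + W * transpose_mat (D3_mat Ny hy)"

definition vlap_h :: "nat \<Rightarrow> nat \<Rightarrow> real \<Rightarrow> real \<Rightarrow> vfield \<Rightarrow> vfield" where
  "vlap_h Nx Ny hx hy U = (lap_h Nx Ny hx hy (fst U), lap_h Nx Ny hx hy (snd U))"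

definition G_op :: "nat \<Rightarrow> nat \<Rightarrow> real \<Rightarrow> real \<Rightarrow> (vfield \<Rightarrow> vfield) \<Rightarrow> vfield \<Rightarrow> vfield" where
  "G_op Nx Ny hx hy F UV =
    (if vnorm_h hx hy UV = 0 then zero_vf Nx Ny
     else let
       U = fst UV; V = snd UV;
       A1 = C_mat Nx; A2 = D1_mat Nx hx; A3 = D2_mat Nx hx;
       B1 = C_mat Ny; B2 = D1_mat Ny hy; B3 = D2_mat Ny hy
     in (1 / vinner_h hx hy (F UV) UV) \<cdot>\<^sub>p
       (U \<odot> (A2 * U) - ((transpose_mat A1 * V) \<odot> (U * B3)) * transpose_mat B1,
        V \<odot> (V * transpose_mat B2) - A1 * ((transpose_mat A3 * V) \<odot> (U * B1))))"

definition B_op ::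
  "nat \<Rightarrow> nat \<Rightarrow> real \<Rightarrow> real \<Rightarrow> (vfield \<Rightarrow> vfield) \<Rightarrow> vfield \<Rightarrow> vfield \<Rightarrow> vfield" where
  "B_op Nx Ny hx hy F U W =
    vinner_h hx hy (F U) W \<cdot>\<^sub>p G_op Nx Ny hx hy F U
    - vinner_h hx hy (G_op Nx Ny hx hy F U) W \<cdot>\<^sub>p F U"

text \<open>In the two schemes below \<open>f\<close> is the force at the new time level, \<open>U\<close> the latest known
  velocity, \<open>U'\<close> the one before it, and \<open>(W, Q)\<close> the unknown new velocity and pressure.\<close>

definition bdf1_scheme ::
  "nat \<Rightarrow> nat \<Rightarrow> real \<Rightarrow> real \<Rightarrow> (vfield \<Rightarrow> vfield) \<Rightarrow> real \<Rightarrow> real \<Rightarrow> vfield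
    \<Rightarrow> vfield \<Rightarrow> vfield \<Rightarrow> gfun \<Rightarrow> bool" where
  "bdf1_scheme Nx Ny hx hy F \<nu> \<tau> f U W Q \<longleftrightarrow>
    (1 / \<tau>) \<cdot>\<^sub>p (W - U) - \<nu> \<cdot>\<^sub>p vlap_h Nx Ny hx hy W
      + B_op Nx Ny hx hy F U W + grad_D Nx Ny hx hy Q = f
    \<and> div_d Nx Ny hx hy W = 0\<^sub>m Nx Ny"

definition bdf2_scheme ::
  "nat \<Rightarrow> nat \<Rightarrow> real \<Rightarrow> real \<Rightarrow> (vfield \<Rightarrow> vfield) \<Rightarrow> real \<Rightarrow> real \<Rightarrow> vfield
    \<Rightarrow> vfield \<Rightarrow> vfield \<Rightarrow> vfield \<Rightarrow> gfun \<Rightarrow> bool" where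
  "bdf2_scheme Nx Ny hx hy F \<nu> \<tau> f U' U W Q \<longleftrightarrow>
    (1 / (2 * \<tau>)) \<cdot>\<^sub>p (3 \<cdot>\<^sub>p W - 4 \<cdot>\<^sub>p U + U') - \<nu> \<cdot>\<^sub>p vlap_h Nx Ny hx hy W
      + B_op Nx Ny hx hy F (2 \<cdot>\<^sub>p U - U') W + grad_D Nx Ny hx hy Q = f
    \<and> div_d Nx Ny hx hy W = 0\<^sub>m Nx Ny"

text \<open>The space of unknowns \<open>(W, Q)\<close>, with the solvability condition \<open>(Q, 1)\<^sub>h = 0\<close>.\<close>

definition unknowns :: "nat \<Rightarrow> nat \<Rightarrow> real \<Rightarrow> real \<Rightarrow> (vfield \<times> gfun) set" where
  "unknowns Nx Ny hx hy =
    {(W, Q). W \<in> Vel Nx Ny \<and> Q \<in> V_c Nx Ny \<and> inner_h hx hy Q (ones_mat Nx Ny) = 0}"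

text \<open>\<open>U 0, \<dots>, U n\<close> (with pressures \<open>P 1, \<dots>, P n\<close>) are the velocities computed by the scheme
  from the initial value \<open>U 0\<close>; the values at later indices are unconstrained.\<close>

definition bdf1_computed ::
  "nat \<Rightarrow> nat \<Rightarrow> real \<Rightarrow> real \<Rightarrow> (vfield \<Rightarrow> vfield) \<Rightarrow> real \<Rightarrow> real \<Rightarrow> (nat \<Rightarrow> vfield)
    \<Rightarrow> nat \<Rightarrow> (nat \<Rightarrow> vfield) \<Rightarrow> (nat \<Rightarrow> gfun) \<Rightarrow> bool" where
  "bdf1_computed Nx Ny hx hy F \<nu> \<tau> f n U P \<longleftrightarrow>
    U 0 \<in> Vel Nx Ny \<and>
    (\<forall>k<n. (U (k + 1), P (k + 1)) \<in> unknowns Nx Ny hx hy \<and>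
      bdf1_scheme Nx Ny hx hy F \<nu> \<tau> (f (k + 1)) (U k) (U (k + 1)) (P (k + 1)))"

definition bdf2_computed ::
  "nat \<Rightarrow> nat \<Rightarrow> real \<Rightarrow> real \<Rightarrow> (vfield \<Rightarrow> vfield) \<Rightarrow> real \<Rightarrow> real \<Rightarrow> (nat \<Rightarrow> vfield)
    \<Rightarrow> nat \<Rightarrow> (nat \<Rightarrow> vfield) \<Rightarrow> (nat \<Rightarrow> gfun) \<Rightarrow> bool" where
  "bdf2_computed Nx Ny hx hy F \<nu> \<tau> f n U P \<longleftrightarrow>
    bdf1_computed Nx Ny hx hy F \<nu> \<tau> f 1 U P \<and>
    (\<forall>k. 1 \<le> k \<and> k < n \<longrightarrow> (U (k + 1), P (k + 1)) \<in> unknowns Nx Ny hx hy \<and>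
      bdf2_scheme Nx Ny hx hy F \<nu> \<tau> (f (k + 1)) (U (k - 1)) (U k) (U (k + 1)) (P (k + 1)))"

end

theory Submission
  imports Defs "Jordan_Normal_Form.Determinant"
begin

text \<open>
  Each time step is a finite linear system for the new velocity \<open>W\<close> and pressure \<open>Q\<close>: the
  nonlinear term \<open>B(U, W)\<close> is linear in its second argument, and its first argument is known from
  the previous steps. Both schemes have the form
  \<open>a W - \<nu> \<Delta>\<^sub>h W + B(U, W) + \<nabla>\<^sub>D Q = g\<close>, \<open>\<nabla>\<^sub>d \<cdot> W = 0\<close>, \<open>(Q, 1)\<^sub>h = 0\<close>
  with \<open>a > 0\<close>, namely \<open>a = 1/\<tau>\<close> and \<open>U\<close> the last velocity for BDF1, and \<open>a = 3/(2\<tau>)\<close> and \<open>U\<close> the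
  extrapolated velocity for BDF2.

  Counted by entries there is one equation too many, which is compensated by the fact that every
  discrete divergence has mean zero (\<open>div_d_mean_zero\<close>). Therefore the divergence constraint and
  the mean value condition can be replaced by the single grid equation \<open>\<nabla>\<^sub>d \<cdot> W + (Q, 1)\<^sub>h 1 = 0\<close> (\<open>penalized_div_eq_0_iff\<close>). The
  resulting system is square, and existence and uniqueness both follow from injectivity
  (\<open>injective_linear_operator_bijective\<close>).

  Injectivity is an energy argument. In the homogeneous system take the inner product of the
  momentum equation with \<open>W\<close>. The term \<open>(B(U, W), W)\<^sub>h\<close> vanishes by the skew form of \<open>B\<close>
  (\<open>B_op_energy\<close>), the pressure term is \<open>- (Q, \<nabla>\<^sub>d \<cdot> W)\<^sub>h = 0\<close> (\<open>grad_D_div_d_adjoint\<close>), and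
  \<open>(\<Delta>\<^sub>h W, W)\<^sub>h \<le> 0\<close> because the second difference is \<open>- D\<^sub>2\<^sup>T D\<^sub>2\<close> (\<open>D3_mat_eq\<close>). Hence \<open>W = 0\<close>.
  The momentum equation then reduces to \<open>\<nabla>\<^sub>D Q = 0\<close>, so \<open>Q\<close> is constant on the periodic grid, and
  its mean value zero forces \<open>Q = 0\<close> (\<open>grad_D_kernel\<close>).\<close>

section \<open>Square linear systems\<close>

lemma injective_square_matrix_solvable:
  fixes A :: "'a :: field mat"
  assumes A: "A \<in> carrier_mat n n" and b: "b \<in> carrier_vec n"
    and inj: "\<And>v. v \<in> carrier_vec n \<Longrightarrow> A *\<^sub>v v = 0\<^sub>v n \<Longrightarrow> v = 0\<^sub>v n"
  obtains v where "v \<in> carrier_vec n" "A *\<^sub>v v = b"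
proof -
  have "det A \<noteq> 0"
    using det_0_iff_vec_prod_zero_field[OF A] inj by blast
  from det_non_zero_imp_unit[OF A this, of "()"]
  obtain B where "B \<in> carrier_mat n n" "A * B = 1\<^sub>m n"
    by (auto simp: Units_def ring_mat_def)
  then have "A *\<^sub>v (B *\<^sub>v b) = b" "B *\<^sub>v b \<in> carrier_vec n"
    using A b by (auto simp flip: assoc_mult_mat_vec)
  then show ?thesis using that by blast
qed

text \<open>Functions on the finite index set \<open>K\<close> become vectors through an enumeration of \<open>K\<close>; the
  columns of the matrix are the values of \<open>L\<close> at the indicator functions \<open>\<delta> j\<close>. Since \<open>L\<close> acts on
  total functions, the injectivity hypothesis only concerns values on \<open>K\<close>; it is what makes the
  matrix injective, and square matrices over a field that are injective are surjective.\<close>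

lemma injective_linear_system_solvable:
  fixes L :: "('k \<Rightarrow> real) \<Rightarrow> 'k \<Rightarrow> real"
  assumes K: "finite K"
    and lin: "\<And>c x y k. k \<in> K \<Longrightarrow> L (\<lambda>l. c * x l + y l) k = c * L x k + L y k"
    and inj: "\<And>x k. (\<And>l. l \<in> K \<Longrightarrow> L x l = 0) \<Longrightarrow> k \<in> K \<Longrightarrow> x k = 0"
  shows "\<exists>x. \<forall>k\<in>K. L x k = b k"
proof -
  define n where "n = card K"
  obtain e where e: "bij_betw e {..<n} K"
    using ex_bij_betw_nat_finite[OF K] unfolding n_def atLeast0LessThan by blast
  have eK: "e i \<in> K" if "i < n" for i
    using e that by (auto simp: bij_betw_def)
  define \<delta> :: "nat \<Rightarrow> 'k \<Rightarrow> real" where "\<delta> j k = of_bool (k = e j)" for j k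
  define A where "A = mat n n (\<lambda>(i, j). L (\<delta> j) (e i))"
  define X :: "real vec \<Rightarrow> 'k \<Rightarrow> real" where "X v k = (\<Sum>j<n. v $ j * \<delta> j k)" for v k
  have L0: "L (\<lambda>_. 0) k = 0" if "k \<in> K" for k
    using lin[OF that, of 1 "\<lambda>_. 0" "\<lambda>_. 0"] by simp
  have "L (\<lambda>k. \<Sum>j\<in>J. v $ j * \<delta> j k) l = (\<Sum>j\<in>J. v $ j * L (\<delta> j) l)"
    if "finite J" "l \<in> K" for J and v :: "real vec" and l
    using that(1) by induction (simp_all add: L0 lin that(2))
  then have LX: "L (X v) (e i) = (A *\<^sub>v v) $ i" if "i < n" "v \<in> carrier_vec n" for v i
    unfolding X_def using that eK
    by (auto simp: A_def scalar_prod_def atLeast0LessThan mult.commute)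
  have X_e: "X v (e i) = v $ i" if "i < n" for v i
  proof -
    have "X v (e i) = (\<Sum>j<n. if j = i then v $ j else 0)"
      unfolding X_def \<delta>_def using e that
      by (intro sum.cong) (auto simp: bij_betw_def inj_on_def)
    then show ?thesis using that by simp
  qed
  have "v = 0\<^sub>v n" if v: "v \<in> carrier_vec n" and Av: "A *\<^sub>v v = 0\<^sub>v n" for v
  proof -
    have "L (X v) k = 0" if k: "k \<in> K" for k
    proof -
      obtain i where "i < n" "k = e i" using e k unfolding bij_betw_def by blast
      then show ?thesis using LX[OF _ v] Av by simp
    qed
    then have "X v (e i) = 0" if "i < n" for i
      using inj eK[OF that] by blast
    then show ?thesis using v by (intro eq_vecI) (auto simp: X_e)
  qed
  then obtain v where v: "v \<in> carrier_vec n" "A *\<^sub>v v = vec n (b \<circ> e)"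
    using injective_square_matrix_solvable[of A n "vec n (b \<circ> e)"]
    by (auto simp: A_def)
  have "L (X v) k = b k" if k: "k \<in> K" for k
  proof -
    obtain i where "i < n" "k = e i" using e k unfolding bij_betw_def by blast
    then show ?thesis using LX[of i v] v by simp
  qed
  then show ?thesis by blast
qed

text \<open>The sum of two states, a state being a velocity together with a pressure, is the sum of
  pairs. Matrices of unspecified size form no real vector space, so scaling needs its own
  symbol, as it does for velocities.\<close>

definition smult_st :: "real \<Rightarrow> vfield \<times> gfun \<Rightarrow> vfield \<times> gfun" (infixr \<open>\<cdot>\<^sub>s\<close> 70) where
  "c \<cdot>\<^sub>s z = (c \<cdot>\<^sub>p fst z, c \<cdot>\<^sub>m snd z)"

abbreviation (input) States :: "nat \<Rightarrow> nat \<Rightarrow> (vfield \<times> gfun) set" where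
  "States Nx Ny \<equiv> Vel Nx Ny \<times> V_c Nx Ny"

text \<open>The coordinate form of the previous lemma: a state is read as a function on
  \<open>{0, 1, 2} \<times> {0..<m} \<times> {0..<n}\<close>, the first entry selecting one of the three components.
  Additivity and homogeneity are required in one equation, which suits operators built by
  composition.\<close>

lemma injective_linear_operator_bijective:
  fixes T :: "vfield \<times> gfun \<Rightarrow> vfield \<times> gfun"
  assumes T: "\<And>z. z \<in> States m n \<Longrightarrow> T z \<in> States m n"
    and lin: "\<And>c z z'. z \<in> States m n \<Longrightarrow> z' \<in> States m n \<Longrightarrow> T (c \<cdot>\<^sub>s z + z') = c \<cdot>\<^sub>s T z + T z'"
    and ker: "\<And>z. z \<in> States m n \<Longrightarrow> T z = (zero_vf m n, 0\<^sub>m m n)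
                \<Longrightarrow> z = (zero_vf m n, 0\<^sub>m m n)"
    and b: "b \<in> States m n"
  shows "\<exists>!z. z \<in> States m n \<and> T z = b"
proof -
  \<comment> \<open>\<open>coord\<close> reads the entries of a state off, \<open>asm\<close> assembles a state from its entries; on
    indices in \<open>K\<close> they are mutually inverse and linear.\<close>
  define K :: "(nat \<times> nat \<times> nat) set" where "K = {..<3} \<times> {..<m} \<times> {..<n}"
  define coord :: "vfield \<times> gfun \<Rightarrow> nat \<times> nat \<times> nat \<Rightarrow> real" where
    "coord z = (\<lambda>(k, ij). (if k = 0 then fst (fst z) else if k = 1 then snd (fst z) else snd z) $$ ij)"
    for z
  define asm :: "(nat \<times> nat \<times> nat \<Rightarrow> real) \<Rightarrow> vfield \<times> gfun" where
    "asm x = ((mat m n (\<lambda>ij. x (0, ij)), mat m n (\<lambda>ij. x (1, ij))), mat m n (\<lambda>ij. x (2, ij)))"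
    for x
  have asm_mem: "asm x \<in> States m n" for x
    by (simp add: asm_def)
  have coord_asm: "coord (asm x) k = x k" if "k \<in> K" for x k
    using that by (auto simp: asm_def coord_def K_def less_Suc_eq numeral_3_eq_3)
      (simp add: numeral_2_eq_2)
  have coord_lin: "coord (c \<cdot>\<^sub>s z + z') k = c * coord z k + coord z' k"
    if "z \<in> States m n" "z' \<in> States m n" "k \<in> K" for c z z' k
    using that by (auto simp: coord_def K_def smult_st_def smult_vf_def)
  have ext: "z = z'" if "z \<in> States m n" "z' \<in> States m n" "\<And>k. k \<in> K \<Longrightarrow> coord z k = coord z' k"
    for z z'
  proof -
    have "fst (fst z) $$ ij = fst (fst z') $$ ij \<and> snd (fst z) $$ ij = snd (fst z') $$ ij
        \<and> snd z $$ ij = snd z' $$ ij" if "ij \<in> {..<m} \<times> {..<n}" for ij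
      using that(1) \<open>\<And>k. k \<in> K \<Longrightarrow> coord z k = coord z' k\<close>[of "(0, ij)"]
        \<open>\<And>k. k \<in> K \<Longrightarrow> coord z k = coord z' k\<close>[of "(1, ij)"]
        \<open>\<And>k. k \<in> K \<Longrightarrow> coord z k = coord z' k\<close>[of "(2, ij)"]
      by (auto simp: coord_def K_def)
    then show ?thesis using that(1,2)
      by (cases z; cases z'; cases "fst z"; cases "fst z'") (auto intro!: eq_matI)
  qed
  have asm_lin: "asm (\<lambda>l. c * x l + y l) = c \<cdot>\<^sub>s asm x + asm y" for c x y
    by (auto simp: asm_def smult_st_def smult_vf_def intro!: eq_matI)
  let ?z0 = "(zero_vf m n, 0\<^sub>m m n)"
  have zero: "?z0 \<in> States m n" "\<And>k. k \<in> K \<Longrightarrow> coord ?z0 k = 0"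
    by (auto simp: zero_vf_def coord_def K_def)
  define L where "L x = coord (T (asm x))" for x
  have "\<exists>x. \<forall>k\<in>K. L x k = coord b k"
  proof (rule injective_linear_system_solvable)
    show "finite K" by (simp add: K_def)
    show "L (\<lambda>l. c * x l + y l) k = c * L x k + L y k" if "k \<in> K" for c x y k
      by (simp only: L_def asm_lin lin[OF asm_mem asm_mem] coord_lin[OF T[OF asm_mem] T[OF asm_mem] that])
    show "x k = 0" if "\<And>l. l \<in> K \<Longrightarrow> L x l = 0" "k \<in> K" for x k
    proof -
      have "T (asm x) = ?z0"
        using that(1) zero by (intro ext) (auto simp only: L_def T[OF asm_mem])
      then have "asm x = ?z0" by (rule ker[OF asm_mem])
      then show ?thesis using coord_asm[OF that(2)] zero(2)[OF that(2)] by metis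
    qed
  qed
  then obtain x where x: "\<And>k. k \<in> K \<Longrightarrow> L x k = coord b k" by blast
  have "T (asm x) = b"
    using x by (intro ext T asm_mem b) (simp add: L_def)
  moreover have "z = z'" if z: "z \<in> States m n" and z': "z' \<in> States m n"
    and eq: "T z = T z'" for z z'
  proof -
    have d: "(- 1) \<cdot>\<^sub>s z + z' \<in> States m n"
      using z z' by (auto simp: smult_st_def smult_vf_def)
    have "T ((- 1) \<cdot>\<^sub>s z + z') = ?z0"
      unfolding lin[OF z z'] eq
      using coord_lin[OF T[OF z'] T[OF z'], of _ "- 1"] T[OF z'] zero
      by (intro ext) (auto simp: smult_st_def smult_vf_def)
    then have "(- 1) \<cdot>\<^sub>s z + z' = ?z0" by (rule ker[OF d])
    then have "coord z k = coord z' k" if "k \<in> K" for k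
      using coord_lin[OF z z' that, of "- 1"] zero(2)[OF that] by simp
    then show ?thesis by (rule ext[OF z z'])
  qed
  ultimately show ?thesis using asm_mem by metis
qed

section \<open>The discrete inner product\<close>

declare minus_carrier_mat [simp]

text \<open>As a rewrite rule, \<open>mult_carrier_mat\<close> leaves the inner dimension undetermined. The
  matrices of the discrete operators are square, which determines it.\<close>

lemma square_mult_carrier [simp]:
  "M \<in> carrier_mat m m \<Longrightarrow> A \<in> carrier_mat m n \<Longrightarrow> M * A \<in> carrier_mat m n"
  "A \<in> carrier_mat m n \<Longrightarrow> M \<in> carrier_mat n n \<Longrightarrow> A * M \<in> carrier_mat m n"
  by (rule mult_carrier_mat; assumption)+

lemma inner_h_entries:
  assumes "A \<in> carrier_mat m n" "B \<in> carrier_mat m n"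
  shows "inner_h hx hy A B = hx * hy * (\<Sum>j<n. \<Sum>i<m. A $$ (i, j) * B $$ (i, j))"
  using assms by (auto simp: inner_h_def trace_mat_def scalar_prod_def atLeast0LessThan
      intro!: sum.cong)

lemma inner_h_commute:
  assumes "A \<in> carrier_mat m n" "B \<in> carrier_mat m n"
  shows "inner_h hx hy A B = inner_h hx hy B A"
  by (simp add: inner_h_entries[OF assms] inner_h_entries[OF assms(2,1)] mult.commute)

lemma inner_h_transpose:
  assumes "A \<in> carrier_mat m n" "B \<in> carrier_mat m n"
  shows "inner_h hx hy (transpose_mat A) (transpose_mat B) = inner_h hx hy A B"
proof -
  have "inner_h hx hy (transpose_mat A) (transpose_mat B) =
      hx * hy * (\<Sum>j<m. \<Sum>i<n. A $$ (j, i) * B $$ (j, i))"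
    using assms by (subst inner_h_entries[of _ n m]) auto
  also have "(\<Sum>j<m. \<Sum>i<n. A $$ (j, i) * B $$ (j, i)) = (\<Sum>i<n. \<Sum>j<m. A $$ (j, i) * B $$ (j, i))"
    by (rule sum.swap)
  finally show ?thesis by (simp add: inner_h_entries[OF assms])
qed

lemma inner_h_add:
  assumes "A \<in> carrier_mat m n" "B \<in> carrier_mat m n" "C \<in> carrier_mat m n"
  shows "inner_h hx hy (A + B) C = inner_h hx hy A C + inner_h hx hy B C"
  using assms by (simp add: inner_h_entries[of _ m n] sum.distrib
      distrib_left distrib_right)

lemma inner_h_smult:
  assumes "A \<in> carrier_mat m n" "C \<in> carrier_mat m n"
  shows "inner_h hx hy (c \<cdot>\<^sub>m A) C = c * inner_h hx hy A C"
  using assms by (simp add: inner_h_entries[of _ m n] sum_distrib_left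
      mult.assoc mult.left_commute)

lemma inner_h_uminus:
  assumes "A \<in> carrier_mat m n" "C \<in> carrier_mat m n"
  shows "inner_h hx hy (- A) C = - inner_h hx hy A C"
  using assms by (simp add: inner_h_entries[of _ m n] sum_negf)

lemma inner_h_diff:
  assumes "A \<in> carrier_mat m n" "B \<in> carrier_mat m n" "C \<in> carrier_mat m n"
  shows "inner_h hx hy (A - B) C = inner_h hx hy A C - inner_h hx hy B C"
  using assms by (simp add: inner_h_entries[of _ m n] sum_subtractf
      left_diff_distrib right_diff_distrib)

lemma inner_h_nonneg:
  assumes "A \<in> carrier_mat m n" "0 < hx" "0 < hy"
  shows "0 \<le> inner_h hx hy A A"
  using assms(2,3) by (simp add: inner_h_entries[OF assms(1,1)] sum_nonneg)

lemma inner_h_definite: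
  assumes "A \<in> carrier_mat m n" "0 < hx" "0 < hy" "inner_h hx hy A A = 0"
  shows "A = 0\<^sub>m m n"
proof -
  have "(\<Sum>j<n. \<Sum>i<m. A $$ (i, j) * A $$ (i, j)) = 0"
    using assms(2-4) by (simp add: inner_h_entries[OF assms(1,1)])
  then have "A $$ (i, j) = 0" if "i < m" "j < n" for i j
    using that by (subst (asm) sum_nonneg_eq_0_iff, simp, simp add: sum_nonneg)
      (auto simp: sum_nonneg_eq_0_iff)
  then show ?thesis using assms(1) by (intro eq_matI) auto
qed

lemma inner_h_mult_left:
  assumes "M \<in> carrier_mat k m" "A \<in> carrier_mat m n" "B \<in> carrier_mat k n"
  shows "inner_h hx hy (M * A) B = inner_h hx hy A (transpose_mat M * B)"
  using assms by (simp add: inner_h_def transpose_mult[OF assms(1,2)])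

text \<open>Transposition preserves the inner product and turns multiplication from the right into
  multiplication from the left, so this is the previous lemma for the transposed matrices.\<close>

lemma inner_h_mult_right:
  assumes "M \<in> carrier_mat k n" "A \<in> carrier_mat m n" "B \<in> carrier_mat m k"
  shows "inner_h hx hy (A * transpose_mat M) B = inner_h hx hy A (B * M)"
proof -
  have "inner_h hx hy (A * transpose_mat M) B
      = inner_h hx hy (transpose_mat (A * transpose_mat M)) (transpose_mat B)"
    using assms by (intro inner_h_transpose[symmetric]) auto
  also have "\<dots> = inner_h hx hy (M * transpose_mat A) (transpose_mat B)"
    using assms by (subst transpose_mult[of _ m n]) auto
  also have "\<dots> = inner_h hx hy (transpose_mat A) (transpose_mat (B * M))"
    using assms by (subst inner_h_mult_left[of _ k n _ m]) (auto simp: transpose_mult[of _ m k _ n])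
  also have "\<dots> = inner_h hx hy A (B * M)"
    using assms by (intro inner_h_transpose) auto
  finally show ?thesis .
qed

section \<open>Periodic difference matrices\<close>

lemma shift_mat_carrier [simp]: "shift_mat N k \<in> carrier_mat N N"
  by (simp add: shift_mat_def)

lemma shift_mat_dim [simp]: "dim_row (shift_mat N k) = N" "dim_col (shift_mat N k) = N"
  by (simp_all add: shift_mat_def)

lemma D2_mat_carrier [simp]: "D2_mat N h \<in> carrier_mat N N"
  by (simp add: D2_mat_def minus_carrier_mat)

lemma D2_mat_dim [simp]: "dim_row (D2_mat N h) = N" "dim_col (D2_mat N h) = N"
  by (simp_all add: D2_mat_def)

lemma D3_mat_carrier [simp]: "D3_mat N h \<in> carrier_mat N N"
  by (simp add: D3_mat_def)

lemma shift_mat_mult_index: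
  assumes "A \<in> carrier_mat N n" "i < N" "j < n"
  shows "(shift_mat N k * A) $$ (i, j) = A $$ (nat ((int i + k) mod int N), j)"
proof -
  define l where "l = nat ((int i + k) mod int N)"
  have l: "l < N" "int l = (int i + k) mod int N"
    using assms(2) by (simp_all add: l_def nat_less_iff)
  have "(shift_mat N k * A) $$ (i, j) = (\<Sum>q<N. of_bool (q = l) * A $$ (q, j))"
    using assms by (auto simp: shift_mat_def scalar_prod_def atLeast0LessThan simp flip: l(2)
        intro!: sum.cong)
  also have "\<dots> = A $$ (l, j)" using l(1) by simp
  finally show ?thesis by (simp add: l_def)
qed

lemma transpose_shift_mat: "transpose_mat (shift_mat N k) = shift_mat N (- k)"
proof -
  have "int j = (int i + k) mod int N \<longleftrightarrow> int i = (int j - k) mod int N"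
    if "i < N" "j < N" for i j
  proof
    assume "int j = (int i + k) mod int N"
    then have "(int j - k) mod int N = (int i + k - k) mod int N"
      by (simp only: mod_diff_left_eq)
    then show "int i = (int j - k) mod int N" using that by simp
  next
    assume "int i = (int j - k) mod int N"
    then have "(int i + k) mod int N = (int j - k + k) mod int N"
      by (simp only: mod_add_left_eq)
    then show "int j = (int i + k) mod int N" using that by simp
  qed
  then show ?thesis by (auto simp: shift_mat_def intro!: eq_matI)
qed

lemma shift_mat_inverse: "shift_mat N (- k) * shift_mat N k = 1\<^sub>m N"
proof (rule eq_matI)
  fix i j assume "i < dim_row (1\<^sub>m N :: real mat)" "j < dim_col (1\<^sub>m N :: real mat)"
  then have ij: "i < N" "j < N" by auto
  let ?l = "(int i - k) mod int N"
  have "nat ?l < N" "(?l + k) mod int N = int i" using ij by (simp_all add: nat_less_iff mod_simps)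
  moreover have "int (nat ?l) = ?l" using ij by simp
  ultimately show "(shift_mat N (- k) * shift_mat N k) $$ (i, j) = 1\<^sub>m N $$ (i, j)"
    using ij by (subst shift_mat_mult_index[of _ N N]) (auto simp: shift_mat_def)
qed (auto simp: shift_mat_def)

lemma transpose_D2_mat: "transpose_mat (D2_mat N h) = (1 / h) \<cdot>\<^sub>m (shift_mat N (- 1) - 1\<^sub>m N)"
proof -
  have "transpose_mat (D2_mat N h) = (1 / h) \<cdot>\<^sub>m transpose_mat (shift_mat N 1 - 1\<^sub>m N)"
    unfolding D2_mat_def by (intro eq_matI) auto
  also have "transpose_mat (shift_mat N 1 - 1\<^sub>m N) = shift_mat N (- 1) - 1\<^sub>m N"
    by (subst transpose_minus[of _ N N]) (auto simp: transpose_shift_mat)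
  finally show ?thesis .
qed

text \<open>Summation by parts in matrix form. With \<open>S\<close> the forward shift and \<open>R = S\<^sup>T = S\<^sup>-\<^sup>1\<close>,
  \<open>(R - 1) (S - 1) = 2 - S - R\<close>. Because it only uses that the shift is orthogonal, it also covers
  the degenerate periods \<open>N = 1\<close> and \<open>N = 2\<close>.\<close>

lemma D3_mat_eq: "D3_mat N h = - (transpose_mat (D2_mat N h) * D2_mat N h)"
proof -
  let ?S = "shift_mat N 1" and ?R = "shift_mat N (- 1)"
  have "(?R - 1\<^sub>m N) * (?S - 1\<^sub>m N) = ?R * (?S - 1\<^sub>m N) - 1\<^sub>m N * (?S - 1\<^sub>m N)"
    by (rule minus_mult_distrib_mat[of _ N N]) (auto intro: minus_carrier_mat)
  also have "?R * (?S - 1\<^sub>m N) = ?R * ?S - ?R * 1\<^sub>m N"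
    by (rule mult_minus_distrib_mat[of _ N N]) auto
  also have "1\<^sub>m N * (?S - 1\<^sub>m N) = ?S - 1\<^sub>m N"
    by (rule left_mult_one_mat[of _ N N]) (auto intro: minus_carrier_mat)
  also have "?R * ?S - ?R * 1\<^sub>m N = 1\<^sub>m N - ?R"
    by (simp add: shift_mat_inverse right_mult_one_mat[of _ N N])
  finally have prod: "(?R - 1\<^sub>m N) * (?S - 1\<^sub>m N) = (1\<^sub>m N - ?R) - (?S - 1\<^sub>m N)" .
  have "transpose_mat (D2_mat N h) * D2_mat N h =
      (1 / h) \<cdot>\<^sub>m ((1 / h) \<cdot>\<^sub>m ((?R - 1\<^sub>m N) * (?S - 1\<^sub>m N)))"
    unfolding transpose_D2_mat unfolding D2_mat_def
    by (simp add: mult_smult_assoc_mat[of _ N N _ N] mult_smult_distrib[of _ N N _ N])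
  also have "(?R - 1\<^sub>m N) * (?S - 1\<^sub>m N) = - (?S - 2 \<cdot>\<^sub>m 1\<^sub>m N + ?R)"
    unfolding prod by (intro eq_matI) auto
  also have "(1 / h) \<cdot>\<^sub>m ((1 / h) \<cdot>\<^sub>m (- (?S - 2 \<cdot>\<^sub>m 1\<^sub>m N + ?R))) = - D3_mat N h"
    unfolding D3_mat_def by (intro eq_matI) (auto simp: power2_eq_square minus_divide_left)
  finally show ?thesis by (simp add: uminus_uminus_mat)
qed

text \<open>Only constants have vanishing difference quotients: the kernel equation says that
  \<open>A\<close> is invariant under the backward shift, so the value in row \<open>Suc i\<close> is the value in row \<open>i\<close>.\<close>

lemma transpose_D2_kernel:
  assumes A: "A \<in> carrier_mat N n" and h: "0 < h"
    and ker: "transpose_mat (D2_mat N h) * A = 0\<^sub>m N n" and "i < N" "j < n"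
  shows "A $$ (i, j) = A $$ (0, j)"
  using \<open>i < N\<close>
proof (induction i)
  case (Suc i)
  have "0\<^sub>m N n = (1 / h) \<cdot>\<^sub>m (shift_mat N (- 1) * A - A)"
    unfolding ker[symmetric] transpose_D2_mat
    by (subst mult_smult_assoc_mat[OF _ A], auto intro: minus_carrier_mat)
      (subst minus_mult_distrib_mat[OF _ _ A], auto simp: left_mult_one_mat[OF A])
  then have "((1 / h) \<cdot>\<^sub>m (shift_mat N (- 1) * A - A)) $$ (Suc i, j) = 0\<^sub>m N n $$ (Suc i, j)"
    by simp
  then have "A $$ (i, j) = A $$ (Suc i, j)"
    using A h Suc.prems \<open>j < n\<close> by (auto simp: shift_mat_mult_index[OF A] simp del: index_mult_mat(1))
  then show ?case using Suc by simp
qed simp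

lemma transpose_D2_const: "transpose_mat (D2_mat N h) * mat N n (\<lambda>_. c) = 0\<^sub>m N n"
proof -
  let ?A = "mat N n (\<lambda>_. c)"
  have A: "?A \<in> carrier_mat N n" by simp
  have "transpose_mat (D2_mat N h) * ?A = (1 / h) \<cdot>\<^sub>m (shift_mat N (- 1) * ?A - ?A)"
    unfolding transpose_D2_mat
    by (subst mult_smult_assoc_mat[OF _ A], auto intro: minus_carrier_mat)
      (subst minus_mult_distrib_mat[OF _ _ A], auto simp: left_mult_one_mat[OF A])
  also have "\<dots> = 0\<^sub>m N n"
    by (intro eq_matI)
      (auto simp: shift_mat_mult_index[OF A] nat_less_iff simp del: index_mult_mat(1))
  finally show ?thesis .
qed

section \<open>The discrete operators\<close>

lemma vinner_h_add:
  assumes "U \<in> Vel m n" "V \<in> Vel m n" "W \<in> Vel m n"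
  shows "vinner_h hx hy (U + V) W = vinner_h hx hy U W + vinner_h hx hy V W"
  using assms by (auto simp: vinner_h_def inner_h_add)

lemma vinner_h_diff:
  assumes "U \<in> Vel m n" "V \<in> Vel m n" "W \<in> Vel m n"
  shows "vinner_h hx hy (U - V) W = vinner_h hx hy U W - vinner_h hx hy V W"
  using assms by (auto simp: vinner_h_def inner_h_diff)

lemma vinner_h_smult:
  assumes "U \<in> Vel m n" "W \<in> Vel m n"
  shows "vinner_h hx hy (c \<cdot>\<^sub>p U) W = c * vinner_h hx hy U W"
  using assms by (auto simp: vinner_h_def smult_vf_def inner_h_smult distrib_left)

lemma vinner_h_commute:
  assumes "U \<in> Vel m n" "W \<in> Vel m n"
  shows "vinner_h hx hy U W = vinner_h hx hy W U"
  using assms by (auto simp: vinner_h_def inner_h_commute[of _ m n])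

lemma vinner_h_definite:
  assumes "U \<in> Vel m n" "0 < hx" "0 < hy" "vinner_h hx hy U U \<le> 0"
  shows "U = zero_vf m n"
proof -
  have "0 \<le> inner_h hx hy (fst U) (fst U)" "0 \<le> inner_h hx hy (snd U) (snd U)"
    using assms by (auto intro: inner_h_nonneg[of _ m n])
  then have "inner_h hx hy (fst U) (fst U) = 0" "inner_h hx hy (snd U) (snd U) = 0"
    using assms(4) by (auto simp: vinner_h_def)
  then show ?thesis
    using assms inner_h_definite[of _ m n hx hy] by (cases U) (auto simp: zero_vf_def)
qed

lemma vf_closed:
  "U \<in> Vel m n \<Longrightarrow> V \<in> Vel m n \<Longrightarrow> U + V \<in> Vel m n"
  "U \<in> Vel m n \<Longrightarrow> V \<in> Vel m n \<Longrightarrow> U - V \<in> Vel m n"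
  "U \<in> Vel m n \<Longrightarrow> c \<cdot>\<^sub>p U \<in> Vel m n"
  by (auto simp: smult_vf_def)

lemma ones_mat_carrier [simp]: "ones_mat m n \<in> carrier_mat m n"
  by (simp add: ones_mat_def)

lemma div_d_carrier: "U \<in> Vel Nx Ny \<Longrightarrow> div_d Nx Ny hx hy U \<in> carrier_mat Nx Ny"
  by (auto simp: div_d_def)

lemma grad_D_mem: "P \<in> carrier_mat Nx Ny \<Longrightarrow> grad_D Nx Ny hx hy P \<in> Vel Nx Ny"
  by (auto simp: grad_D_def)

lemma lap_h_carrier: "W \<in> carrier_mat Nx Ny \<Longrightarrow> lap_h Nx Ny hx hy W \<in> carrier_mat Nx Ny"
  by (simp add: lap_h_def mult_carrier_mat)

lemma vlap_h_mem: "U \<in> Vel Nx Ny \<Longrightarrow> vlap_h Nx Ny hx hy U \<in> Vel Nx Ny"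
  by (auto simp: vlap_h_def lap_h_carrier)

lemma C_mat_carrier [simp]: "C_mat N \<in> carrier_mat N N"
  by (simp add: C_mat_def)

lemma D1_mat_carrier [simp]: "D1_mat N h \<in> carrier_mat N N"
  by (simp add: D1_mat_def minus_carrier_mat)

lemma hadamard_carrier: "A \<in> carrier_mat m n \<Longrightarrow> A \<odot> B \<in> carrier_mat m n"
  by (simp add: hadamard_def)

lemma G_op_mem: "U \<in> Vel Nx Ny \<Longrightarrow> G_op Nx Ny hx hy F U \<in> Vel Nx Ny"
  by (auto simp: G_op_def Let_def zero_vf_def smult_vf_def
      hadamard_carrier)

lemma B_op_mem:
  assumes "U \<in> Vel Nx Ny" "F U \<in> Vel Nx Ny"
  shows "B_op Nx Ny hx hy F U W \<in> Vel Nx Ny"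
  unfolding B_op_def using assms by (intro vf_closed G_op_mem) (auto simp: zero_vf_def)

text \<open>Linearity of an operator is stated for combinations \<open>c X + Y\<close>, the form in which the solvability
  criterion asks for it.\<close>

lemma mult_linear_left:
  assumes "M \<in> carrier_mat k m" "A \<in> carrier_mat m n" "B \<in> carrier_mat m n"
  shows "M * (c \<cdot>\<^sub>m A + B) = (c :: real) \<cdot>\<^sub>m (M * A) + M * B"
  using assms by (simp add: mult_add_distrib_mat[of _ k m _ n] mult_smult_distrib[of _ k m _ n])

lemma mult_linear_right:
  assumes "M \<in> carrier_mat n k" "A \<in> carrier_mat m n" "B \<in> carrier_mat m n"
  shows "(c \<cdot>\<^sub>m A + B) * M = (c :: real) \<cdot>\<^sub>m (A * M) + B * M"
  using assms by (simp add: add_mult_distrib_mat[of _ m n _ _ k] mult_smult_assoc_mat[of _ m n _ k])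

lemma smult_add_interchange:
  assumes "A \<in> carrier_mat m n" "B \<in> carrier_mat m n" "C \<in> carrier_mat m n" "D \<in> carrier_mat m n"
  shows "(c \<cdot>\<^sub>m A + B) + (c \<cdot>\<^sub>m C + D) = (c :: real) \<cdot>\<^sub>m (A + C) + (B + D)"
  using assms by (intro eq_matI) (auto simp: distrib_left)

lemma uminus_smult_add:
  assumes "A \<in> carrier_mat m n" "B \<in> carrier_mat m n"
  shows "- (c \<cdot>\<^sub>m A + B) = (c :: real) \<cdot>\<^sub>m (- A) + (- B)"
  using assms by (intro eq_matI) auto

lemma div_d_linear:
  assumes "U \<in> Vel Nx Ny" "V \<in> Vel Nx Ny"
  shows "div_d Nx Ny hx hy (c \<cdot>\<^sub>p U + V) = c \<cdot>\<^sub>m div_d Nx Ny hx hy U + div_d Nx Ny hx hy V"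
  using assms
  by (auto simp: div_d_def smult_vf_def mult_linear_left[of _ Nx Nx _ Ny]
      mult_linear_right[of _ Ny Ny _ Nx] smult_add_interchange[of _ Nx Ny])

lemma grad_D_linear:
  assumes "P \<in> carrier_mat Nx Ny" "Q \<in> carrier_mat Nx Ny"
  shows "grad_D Nx Ny hx hy (c \<cdot>\<^sub>m P + Q) = c \<cdot>\<^sub>p grad_D Nx Ny hx hy P + grad_D Nx Ny hx hy Q"
  using assms
  by (simp add: grad_D_def smult_vf_def mult_linear_left[of _ Nx Nx _ Ny]
      mult_linear_right[of _ Ny Ny _ Nx] uminus_smult_add[of _ Nx Ny])

lemma lap_h_linear:
  assumes "A \<in> carrier_mat Nx Ny" "B \<in> carrier_mat Nx Ny"
  shows "lap_h Nx Ny hx hy (c \<cdot>\<^sub>m A + B) = c \<cdot>\<^sub>m lap_h Nx Ny hx hy A + lap_h Nx Ny hx hy B"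
  using assms
  by (simp add: lap_h_def mult_linear_left[of _ Nx Nx _ Ny]
      mult_linear_right[of _ Ny Ny _ Nx] smult_add_interchange[of _ Nx Ny])

lemma vlap_h_linear:
  assumes "U \<in> Vel Nx Ny" "V \<in> Vel Nx Ny"
  shows "vlap_h Nx Ny hx hy (c \<cdot>\<^sub>p U + V) = c \<cdot>\<^sub>p vlap_h Nx Ny hx hy U + vlap_h Nx Ny hx hy V"
  using assms by (cases U; cases V) (simp add: vlap_h_def smult_vf_def lap_h_linear)

lemma vinner_h_linear_right:
  assumes "X \<in> Vel m n" "U \<in> Vel m n" "V \<in> Vel m n"
  shows "vinner_h hx hy X (c \<cdot>\<^sub>p U + V) = c * vinner_h hx hy X U + vinner_h hx hy X V"
proof -
  have cU: "c \<cdot>\<^sub>p U \<in> Vel m n" using assms(2) by (rule vf_closed)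
  have "vinner_h hx hy X (c \<cdot>\<^sub>p U + V) = vinner_h hx hy (c \<cdot>\<^sub>p U + V) X"
    by (rule vinner_h_commute[OF assms(1) vf_closed(1)[OF cU assms(3)]])
  also have "\<dots> = c * vinner_h hx hy U X + vinner_h hx hy V X"
    by (simp only: vinner_h_add[OF cU assms(3,1)] vinner_h_smult[OF assms(2,1)])
  finally show ?thesis
    by (simp only: vinner_h_commute[OF assms(2,1)] vinner_h_commute[OF assms(3,1)])
qed

lemma vf_eq_iff:
  assumes "U \<in> Vel m n" "V \<in> Vel m n"
  shows "U = V \<longleftrightarrow> (\<forall>i<m. \<forall>j<n. fst U $$ (i, j) = fst V $$ (i, j) \<and> snd U $$ (i, j) = snd V $$ (i, j))"
  using assms by (cases U; cases V) (auto simp: mat_eq_iff)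

lemma B_op_linear:
  assumes "U \<in> Vel Nx Ny" "F U \<in> Vel Nx Ny" "V \<in> Vel Nx Ny" "W \<in> Vel Nx Ny"
  shows "B_op Nx Ny hx hy F U (c \<cdot>\<^sub>p V + W) = c \<cdot>\<^sub>p B_op Nx Ny hx hy F U V + B_op Nx Ny hx hy F U W"
proof -
  define G where "G = G_op Nx Ny hx hy F U"
  have G: "G \<in> Vel Nx Ny" using assms by (simp only: G_def G_op_mem)
  show ?thesis
    unfolding B_op_def G_def[symmetric]
      vinner_h_linear_right[OF G assms(3,4)] vinner_h_linear_right[OF assms(2-4)]
    using G assms(2)
    by (subst vf_eq_iff[of _ Nx Ny]) (auto simp: smult_vf_def algebra_simps)
qed

text \<open>Pairing \<open>B(U, W)\<close> with \<open>W\<close> produces the product \<open>(F(U), W) (G(U), W)\<close> twice, with opposite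
  signs. This discrete form of the energy neutrality of convection is what the shape of \<open>B\<close> is
  made for.\<close>

lemma B_op_energy:
  assumes "U \<in> Vel Nx Ny" "F U \<in> Vel Nx Ny" "W \<in> Vel Nx Ny"
  shows "vinner_h hx hy (B_op Nx Ny hx hy F U W) W = 0"
proof -
  let ?G = "G_op Nx Ny hx hy F U"
  have G: "?G \<in> Vel Nx Ny" by (rule G_op_mem[OF assms(1)])
  show ?thesis
    by (simp only: B_op_def vinner_h_diff[OF vf_closed(3)[OF G] vf_closed(3)[OF assms(2)] assms(3)]
        vinner_h_smult[OF G assms(3)] vinner_h_smult[OF assms(2,3)]) simp
qed

text \<open>By the factorization of the second difference, the left-hand side is
  \<open>- \<parallel>D\<^sub>2 A\<parallel>\<^sup>2\<close>.\<close>

lemma D3_mat_energy: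
  assumes A: "A \<in> carrier_mat N n" and pos: "0 < hx" "0 < hy"
  shows "inner_h hx hy (D3_mat N h * A) A \<le> 0"
proof -
  let ?D = "D2_mat N h"
  have DA: "?D * A \<in> carrier_mat N n" using A by simp
  have "D3_mat N h * A = - (transpose_mat ?D * (?D * A))"
    using A by (simp add: D3_mat_eq assoc_mult_mat[of _ N N _ N _ n])
  moreover have "inner_h hx hy (transpose_mat ?D * (?D * A)) A = inner_h hx hy (?D * A) (?D * A)"
    using inner_h_mult_left[of "transpose_mat ?D" N N "?D * A" n A] A DA by simp
  moreover have "transpose_mat ?D * (?D * A) \<in> carrier_mat N n" using DA by simp
  ultimately show ?thesis
    using A inner_h_nonneg[OF DA pos] by (simp add: inner_h_uminus[of _ N n])
qed

text \<open>The \<open>y\<close>-part of the Laplacian is the one-dimensional case for the transposed matrix.\<close>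

lemma lap_h_energy:
  assumes A: "A \<in> carrier_mat Nx Ny" and pos: "0 < hx" "0 < hy"
  shows "inner_h hx hy (lap_h Nx Ny hx hy A) A \<le> 0"
proof -
  let ?Y = "D3_mat Ny hy"
  have car: "D3_mat Nx hx * A \<in> carrier_mat Nx Ny" "A * transpose_mat ?Y \<in> carrier_mat Nx Ny"
    using A by auto
  have "inner_h hx hy (A * transpose_mat ?Y) A =
      inner_h hx hy (transpose_mat (A * transpose_mat ?Y)) (transpose_mat A)"
    using inner_h_transpose[OF car(2) A] by simp
  also have "transpose_mat (A * transpose_mat ?Y) = ?Y * transpose_mat A"
    using transpose_mult[OF A, of "transpose_mat ?Y" Ny] by simp
  finally show ?thesis
    using D3_mat_energy[OF A pos, of hx] D3_mat_energy[of "transpose_mat A" Ny Nx hx hy hy] A pos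
    by (simp add: lap_h_def inner_h_add[OF car A])
qed

lemma vlap_h_energy:
  assumes "U \<in> Vel Nx Ny" "0 < hx" "0 < hy"
  shows "vinner_h hx hy (vlap_h Nx Ny hx hy U) U \<le> 0"
  using lap_h_energy[of "fst U" Nx Ny hx hy] lap_h_energy[of "snd U" Nx Ny hx hy] assms
  by (auto simp: vinner_h_def vlap_h_def)

lemma grad_D_div_d_adjoint:
  assumes P: "P \<in> carrier_mat Nx Ny" and U: "U \<in> Vel Nx Ny"
  shows "vinner_h hx hy (grad_D Nx Ny hx hy P) U = - inner_h hx hy P (div_d Nx Ny hx hy U)"
proof -
  let ?A = "D2_mat Nx hx" and ?B = "D2_mat Ny hy"
  have U': "fst U \<in> carrier_mat Nx Ny" "snd U \<in> carrier_mat Nx Ny" using U by auto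
  have car: "?A * fst U \<in> carrier_mat Nx Ny" "snd U * transpose_mat ?B \<in> carrier_mat Nx Ny"
    "transpose_mat ?A * P \<in> carrier_mat Nx Ny" "P * ?B \<in> carrier_mat Nx Ny"
    using U' P by auto
  have "inner_h hx hy (transpose_mat ?A * P) (fst U) = inner_h hx hy (?A * fst U) P"
    using inner_h_mult_left[OF D2_mat_carrier U'(1) P] inner_h_commute[OF U'(1) car(3)]
      inner_h_commute[OF U'(1) car(3)] by simp
  moreover have "inner_h hx hy (P * ?B) (snd U) = inner_h hx hy (snd U * transpose_mat ?B) P"
    using inner_h_mult_right[OF D2_mat_carrier U'(2) P] inner_h_commute[OF U'(2) car(4)] by simp
  moreover have "inner_h hx hy P (div_d Nx Ny hx hy U) = inner_h hx hy (div_d Nx Ny hx hy U) P"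
    by (rule inner_h_commute[OF P div_d_carrier[OF U]])
  ultimately show ?thesis
    by (simp add: vinner_h_def grad_D_def div_d_def inner_h_add[OF car(1,2) P]
        inner_h_uminus[OF car(3) U'(1)] inner_h_uminus[OF car(4) U'(2)])
qed

lemma grad_D_ones: "grad_D Nx Ny hx hy (ones_mat Nx Ny) = zero_vf Nx Ny"
proof -
  have "ones_mat Nx Ny * D2_mat Ny hy =
      transpose_mat (transpose_mat (D2_mat Ny hy) * transpose_mat (ones_mat Nx Ny))"
    by (subst transpose_mult[of _ Ny Ny _ Nx]) auto
  also have "transpose_mat (ones_mat Nx Ny) = mat Ny Nx (\<lambda>_. 1)"
    by (auto simp: ones_mat_def)
  finally have "ones_mat Nx Ny * D2_mat Ny hy = 0\<^sub>m Nx Ny"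
    by (simp add: transpose_D2_const)
  then show ?thesis
    by (auto simp: grad_D_def zero_vf_def ones_mat_def transpose_D2_const mat_eq_iff)
qed

text \<open>The discrete divergence theorem: by duality the mean of the divergence is the pairing of
  the velocity with the gradient of a constant, which vanishes.\<close>

lemma div_d_mean_zero:
  assumes "U \<in> Vel Nx Ny"
  shows "inner_h hx hy (div_d Nx Ny hx hy U) (ones_mat Nx Ny) = 0"
proof -
  have "inner_h hx hy (div_d Nx Ny hx hy U) (ones_mat Nx Ny) =
      - vinner_h hx hy (grad_D Nx Ny hx hy (ones_mat Nx Ny)) U"
    using assms grad_D_div_d_adjoint[of "ones_mat Nx Ny" Nx Ny U hx hy]
      inner_h_commute[of "ones_mat Nx Ny" Nx Ny "div_d Nx Ny hx hy U" hx hy]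
    by (simp add: div_d_carrier)
  also have "\<dots> = 0"
    using assms by (auto simp: grad_D_ones vinner_h_def zero_vf_def inner_h_entries[of _ Nx Ny])
  finally show ?thesis .
qed

lemma inner_h_ones:
  "inner_h hx hy (ones_mat Nx Ny) (ones_mat Nx Ny) = hx * hy * (real Nx * real Ny)"
  by (simp add: inner_h_entries[of _ Nx Ny]) (simp add: ones_mat_def)

text \<open>Invariance under the shifts in both directions makes \<open>P\<close> constant, and the mean value
  condition leaves only the constant \<open>0\<close>.\<close>

lemma grad_D_kernel:
  assumes P: "P \<in> carrier_mat Nx Ny" and pos: "0 < hx" "0 < hy"
    and ker: "grad_D Nx Ny hx hy P = zero_vf Nx Ny"
    and mean: "inner_h hx hy P (ones_mat Nx Ny) = 0"
  shows "P = 0\<^sub>m Nx Ny"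
proof -
  have neg: "A = 0\<^sub>m Nx Ny" if "- A = 0\<^sub>m Nx Ny" for A :: gfun
    using that by (auto simp: mat_eq_iff)
  have PB: "P * D2_mat Ny hy = 0\<^sub>m Nx Ny" and AP: "transpose_mat (D2_mat Nx hx) * P = 0\<^sub>m Nx Ny"
    using ker neg by (auto simp: grad_D_def zero_vf_def)
  have "transpose_mat (D2_mat Ny hy) * transpose_mat P = transpose_mat (P * D2_mat Ny hy)"
    by (rule transpose_mult[symmetric, OF P D2_mat_carrier])
  then have PB': "transpose_mat (D2_mat Ny hy) * transpose_mat P = 0\<^sub>m Ny Nx"
    by (simp add: PB)
  define c where "c = P $$ (0, 0)"
  have const: "P $$ (i, j) = c" if "i < Nx" "j < Ny" for i j
  proof -
    have "transpose_mat P $$ (j, 0) = transpose_mat P $$ (0, 0)"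
      using transpose_D2_kernel[OF _ pos(2) PB', of j 0] P that by simp
    then have "P $$ (0, j) = c" using P that by (auto simp: c_def)
    then show ?thesis using transpose_D2_kernel[OF P pos(1) AP that] by simp
  qed
  then have P_eq: "P = c \<cdot>\<^sub>m ones_mat Nx Ny"
    using P by (intro eq_matI) (auto simp: ones_mat_def)
  have "c * (hx * hy * (real Nx * real Ny)) = 0"
    using mean unfolding P_eq by (simp only: inner_h_smult[of _ Nx Ny] ones_mat_carrier inner_h_ones)
  then have "c = 0 \<or> Nx = 0 \<or> Ny = 0"
    using pos by simp
  then show ?thesis
    unfolding P_eq by (intro eq_matI) (auto simp: ones_mat_def)
qed

section \<open>The linear problem of a time step\<close>

text \<open>Both schemes ask for the same linear problem. In the following left-hand side of the
  momentum equation, \<open>a\<close> is the coefficient of the new velocity in the time difference quotient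
  and \<open>U\<close> the known velocity that enters the nonlinear term; the known part of the quotient
  belongs to the right-hand side.\<close>

definition momentum ::
  "nat \<Rightarrow> nat \<Rightarrow> real \<Rightarrow> real \<Rightarrow> (vfield \<Rightarrow> vfield) \<Rightarrow> real \<Rightarrow> real \<Rightarrow> vfield
    \<Rightarrow> vfield \<times> gfun \<Rightarrow> vfield" where
  "momentum Nx Ny hx hy F \<nu> a U z =
    a \<cdot>\<^sub>p fst z - \<nu> \<cdot>\<^sub>p vlap_h Nx Ny hx hy (fst z) + B_op Nx Ny hx hy F U (fst z)
      + grad_D Nx Ny hx hy (snd z)"

text \<open>The divergence constraint and the condition of zero mean have together one equation more
  than there are entries in a grid function, while the divergence misses the constants. Putting the
  mean of the pressure on the constants merges both into one grid function and makes the
  number of equations equal to that of unknowns.\<close>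

definition penalized_div :: "nat \<Rightarrow> nat \<Rightarrow> real \<Rightarrow> real \<Rightarrow> vfield \<times> gfun \<Rightarrow> gfun" where
  "penalized_div Nx Ny hx hy z =
    div_d Nx Ny hx hy (fst z) + inner_h hx hy (snd z) (ones_mat Nx Ny) \<cdot>\<^sub>m ones_mat Nx Ny"

text \<open>The divergence is orthogonal to the constants, so the two summands vanish separately.\<close>

lemma penalized_div_eq_0_iff:
  assumes z: "z \<in> States Nx Ny" and pos: "0 < Nx" "0 < Ny" "0 < hx" "0 < hy"
  shows "penalized_div Nx Ny hx hy z = 0\<^sub>m Nx Ny \<longleftrightarrow>
    div_d Nx Ny hx hy (fst z) = 0\<^sub>m Nx Ny \<and> inner_h hx hy (snd z) (ones_mat Nx Ny) = 0"
proof
  let ?e = "ones_mat Nx Ny" and ?d = "div_d Nx Ny hx hy (fst z)"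
  let ?s = "inner_h hx hy (snd z) ?e"
  have z1: "fst z \<in> Vel Nx Ny" using z by auto
  have d: "?d \<in> carrier_mat Nx Ny" using z1 by (rule div_d_carrier)
  show "?d = 0\<^sub>m Nx Ny \<and> ?s = 0" if "penalized_div Nx Ny hx hy z = 0\<^sub>m Nx Ny"
  proof -
    have "inner_h hx hy (?d + ?s \<cdot>\<^sub>m ?e) ?e = inner_h hx hy (0\<^sub>m Nx Ny) ?e"
      using that by (simp add: penalized_div_def)
    then have "?s * (hx * hy * (real Nx * real Ny)) = 0"
      using d by (simp add: inner_h_add[of _ Nx Ny] inner_h_smult[of _ Nx Ny] inner_h_ones
          div_d_mean_zero[OF z1]) (simp add: inner_h_entries[of _ Nx Ny])
    then have "?s = 0" using pos by simp
    moreover from this have "?d = 0\<^sub>m Nx Ny"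
      using that d by (auto simp: penalized_div_def mat_eq_iff)
    ultimately show ?thesis by simp
  qed
  show "penalized_div Nx Ny hx hy z = 0\<^sub>m Nx Ny" if "?d = 0\<^sub>m Nx Ny \<and> ?s = 0"
  proof -
    have "0 \<cdot>\<^sub>m ?e = 0\<^sub>m Nx Ny" by (rule eq_matI) (simp_all add: ones_mat_def)
    then show ?thesis using that by (simp add: penalized_div_def)
  qed
qed

lemma momentum_mem:
  assumes "U \<in> Vel Nx Ny" "F U \<in> Vel Nx Ny" "z \<in> States Nx Ny"
  shows "momentum Nx Ny hx hy F \<nu> a U z \<in> Vel Nx Ny"
  unfolding momentum_def using assms
  by (intro vf_closed vlap_h_mem B_op_mem grad_D_mem) (auto simp only: mem_Times_iff)

lemma momentum_linear:
  assumes U: "U \<in> Vel Nx Ny" "F U \<in> Vel Nx Ny" and z: "z \<in> States Nx Ny" "z' \<in> States Nx Ny"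
  shows "momentum Nx Ny hx hy F \<nu> a U (c \<cdot>\<^sub>s z + z') =
    c \<cdot>\<^sub>p momentum Nx Ny hx hy F \<nu> a U z + momentum Nx Ny hx hy F \<nu> a U z'"
proof -
  have V: "fst z \<in> Vel Nx Ny" "fst z' \<in> Vel Nx Ny" "snd z \<in> carrier_mat Nx Ny"
    "snd z' \<in> carrier_mat Nx Ny"
    using z by auto
  have "a \<cdot>\<^sub>m (c \<cdot>\<^sub>m W + W') - \<nu> \<cdot>\<^sub>m (c \<cdot>\<^sub>m L + L') + (c \<cdot>\<^sub>m B + B') + (c \<cdot>\<^sub>m G + G') =
      c \<cdot>\<^sub>m (a \<cdot>\<^sub>m W - \<nu> \<cdot>\<^sub>m L + B + G) + (a \<cdot>\<^sub>m W' - \<nu> \<cdot>\<^sub>m L' + B' + G')"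
    if "W \<in> carrier_mat Nx Ny" "W' \<in> carrier_mat Nx Ny" "L \<in> carrier_mat Nx Ny"
      "L' \<in> carrier_mat Nx Ny" "B \<in> carrier_mat Nx Ny" "B' \<in> carrier_mat Nx Ny"
      "G \<in> carrier_mat Nx Ny" "G' \<in> carrier_mat Nx Ny" for W W' L L' B B' G G' :: gfun
    by (rule eq_matI) (simp_all add: that[THEN carrier_matD(1)] that[THEN carrier_matD(2)]
        right_diff_distrib distrib_left mult.left_commute)
  then have "a \<cdot>\<^sub>p (c \<cdot>\<^sub>p W + W') - \<nu> \<cdot>\<^sub>p (c \<cdot>\<^sub>p L + L') + (c \<cdot>\<^sub>p B + B') + (c \<cdot>\<^sub>p G + G') =
      c \<cdot>\<^sub>p (a \<cdot>\<^sub>p W - \<nu> \<cdot>\<^sub>p L + B + G) + (a \<cdot>\<^sub>p W' - \<nu> \<cdot>\<^sub>p L' + B' + G')"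
    if "W \<in> Vel Nx Ny" "W' \<in> Vel Nx Ny" "L \<in> Vel Nx Ny" "L' \<in> Vel Nx Ny" "B \<in> Vel Nx Ny"
      "B' \<in> Vel Nx Ny" "G \<in> Vel Nx Ny" "G' \<in> Vel Nx Ny" for W W' L L' B B' G G'
    using that by (simp add: smult_vf_def prod_eq_iff mem_Times_iff)
  from this[OF V(1,2) vlap_h_mem[OF V(1)] vlap_h_mem[OF V(2)] B_op_mem[of U Nx Ny F, OF U]
      B_op_mem[of U Nx Ny F, OF U] grad_D_mem[OF V(3)] grad_D_mem[OF V(4)]]
  show ?thesis
    by (simp only: momentum_def smult_st_def fst_add snd_add fst_conv snd_conv
      vlap_h_linear[OF V(1,2)] B_op_linear[of U Nx Ny F, OF U V(1,2)] grad_D_linear[OF V(3,4)])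
qed

lemma penalized_div_linear:
  assumes z: "z \<in> States Nx Ny" "z' \<in> States Nx Ny"
  shows "penalized_div Nx Ny hx hy (c \<cdot>\<^sub>s z + z') =
    c \<cdot>\<^sub>m penalized_div Nx Ny hx hy z + penalized_div Nx Ny hx hy z'"
proof -
  have V: "fst z \<in> Vel Nx Ny" "fst z' \<in> Vel Nx Ny" "snd z \<in> carrier_mat Nx Ny"
    "snd z' \<in> carrier_mat Nx Ny"
    using z by auto
  show ?thesis
    using V div_d_carrier[OF V(1), of hx hy] div_d_carrier[OF V(2), of hx hy]
    unfolding penalized_div_def smult_st_def fst_add snd_add fst_conv snd_conv div_d_linear[OF V(1,2)]
    by (simp add: inner_h_add[of _ Nx Ny] inner_h_smult[of _ Nx Ny])
      (intro eq_matI; auto simp: ones_mat_def algebra_simps)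
qed

text \<open>Testing with a divergence-free velocity removes the pressure, by duality of gradient and
  divergence, and the nonlinear term; the viscous term has a sign.\<close>

lemma momentum_energy:
  assumes U: "U \<in> Vel Nx Ny" "F U \<in> Vel Nx Ny" and z: "z \<in> States Nx Ny"
    and pos: "0 < hx" "0 < hy" "0 \<le> \<nu>"
    and div: "div_d Nx Ny hx hy (fst z) = 0\<^sub>m Nx Ny"
  shows "a * vinner_h hx hy (fst z) (fst z)
    \<le> vinner_h hx hy (momentum Nx Ny hx hy F \<nu> a U z) (fst z)"
proof -
  let ?W = "fst z"
  have W: "?W \<in> Vel Nx Ny" and Q: "snd z \<in> carrier_mat Nx Ny" using z by auto
  note mem = vlap_h_mem[OF W] B_op_mem[of U Nx Ny F, OF U] grad_D_mem[OF Q]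
  have "inner_h hx hy (snd z) (0\<^sub>m Nx Ny) = 0"
    using Q by (simp add: inner_h_entries[of _ Nx Ny])
  then have grad: "vinner_h hx hy (grad_D Nx Ny hx hy (snd z)) ?W = 0"
    using grad_D_div_d_adjoint[OF Q W] by (simp add: div)
  have "vinner_h hx hy (momentum Nx Ny hx hy F \<nu> a U z) ?W =
      a * vinner_h hx hy ?W ?W - \<nu> * vinner_h hx hy (vlap_h Nx Ny hx hy ?W) ?W"
    unfolding momentum_def
    by (simp only: vinner_h_add[of _ Nx Ny] vinner_h_diff[of _ Nx Ny] vinner_h_smult[of _ Nx Ny]
        vf_closed[of _ Nx Ny] mem W grad B_op_energy[of U Nx Ny F, OF U W] add_0_right)
  moreover have "\<nu> * vinner_h hx hy (vlap_h Nx Ny hx hy ?W) ?W \<le> 0"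
    using vlap_h_energy[OF W pos(1,2)] pos(3) by (simp add: mult_nonneg_nonpos)
  ultimately show ?thesis by linarith
qed

text \<open>What is left of the homogeneous problem once the energy estimate has shown that its
  velocity vanishes.\<close>

lemma momentum_zero_velocity:
  assumes U: "U \<in> Vel Nx Ny" "F U \<in> Vel Nx Ny" and Q: "Q \<in> carrier_mat Nx Ny"
  shows "momentum Nx Ny hx hy F \<nu> a U (zero_vf Nx Ny, Q) = grad_D Nx Ny hx hy Q"
proof -
  have v0: "vinner_h hx hy X (zero_vf Nx Ny) = 0" if "X \<in> Vel Nx Ny" for X
    using that by (auto simp: vinner_h_def zero_vf_def inner_h_entries[of _ Nx Ny])
  have "vlap_h Nx Ny hx hy (zero_vf Nx Ny) = zero_vf Nx Ny"
    by (simp add: vlap_h_def lap_h_def zero_vf_def right_mult_zero_mat[of _ Nx Nx]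
        left_mult_zero_mat[of _ Ny Ny])
  moreover have "B_op Nx Ny hx hy F U (zero_vf Nx Ny) = zero_vf Nx Ny"
    unfolding B_op_def v0[OF U(2)] v0[OF G_op_mem[OF U(1)]]
    using U(2) G_op_mem[OF U(1), of hx hy F]
    by (subst vf_eq_iff[of _ Nx Ny]) (auto simp: smult_vf_def zero_vf_def)
  ultimately show ?thesis
    using grad_D_mem[OF Q, of hx hy]
    by (subst vf_eq_iff[of _ Nx Ny]) (auto simp: momentum_def zero_vf_def smult_vf_def)
qed

text \<open>The system is square and linear, so it suffices that the homogeneous system has only the
  zero solution. There the energy estimate gives \<open>a \<parallel>W\<parallel>\<^sup>2 \<le> 0\<close>, hence a zero velocity, and then the
  pressure has zero gradient and zero mean.\<close>

lemma time_step_uniquely_solvable: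
  assumes pos: "0 < Nx" "0 < Ny" "0 < hx" "0 < hy" "0 \<le> \<nu>" "0 < a"
    and U: "U \<in> Vel Nx Ny" "F U \<in> Vel Nx Ny" and g: "g \<in> Vel Nx Ny"
  shows "\<exists>!z. z \<in> unknowns Nx Ny hx hy \<and> momentum Nx Ny hx hy F \<nu> a U z = g
    \<and> div_d Nx Ny hx hy (fst z) = 0\<^sub>m Nx Ny"
proof -
  define T where "T z = (momentum Nx Ny hx hy F \<nu> a U z, penalized_div Nx Ny hx hy z)" for z
  note pd_iff = penalized_div_eq_0_iff[OF _ pos(1-4)]
  have pd_mem: "penalized_div Nx Ny hx hy z \<in> carrier_mat Nx Ny" if "z \<in> States Nx Ny" for z
    using that by (auto simp: penalized_div_def)
  have "\<exists>!z. z \<in> States Nx Ny \<and> T z = (g, 0\<^sub>m Nx Ny)"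
  proof (rule injective_linear_operator_bijective)
    show "T z \<in> States Nx Ny" if "z \<in> States Nx Ny" for z
      using momentum_mem[of U Nx Ny F z, OF U that] pd_mem[OF that] by (simp add: T_def)
    show "T (c \<cdot>\<^sub>s z + z') = c \<cdot>\<^sub>s T z + T z'" if "z \<in> States Nx Ny" "z' \<in> States Nx Ny" for c z z'
      by (simp add: T_def momentum_linear[of U Nx Ny F, OF U that] penalized_div_linear[OF that])
        (simp add: smult_st_def)
    show "z = (zero_vf Nx Ny, 0\<^sub>m Nx Ny)"
      if z: "z \<in> States Nx Ny" and Tz: "T z = (zero_vf Nx Ny, 0\<^sub>m Nx Ny)" for z
    proof -
      have W: "fst z \<in> Vel Nx Ny" and Q: "snd z \<in> carrier_mat Nx Ny" using z by auto
      have mom: "momentum Nx Ny hx hy F \<nu> a U z = zero_vf Nx Ny"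
        and div: "div_d Nx Ny hx hy (fst z) = 0\<^sub>m Nx Ny"
        and mean: "inner_h hx hy (snd z) (ones_mat Nx Ny) = 0"
        using Tz pd_iff[OF z] by (auto simp: T_def)
      have "vinner_h hx hy (zero_vf Nx Ny) (fst z) = 0"
        using W by (auto simp: vinner_h_def zero_vf_def inner_h_entries[of _ Nx Ny])
      then have "a * vinner_h hx hy (fst z) (fst z) \<le> 0"
        using momentum_energy[of U Nx Ny F z hx hy, OF U z pos(3-5) div, of a] by (simp add: mom)
      then have "vinner_h hx hy (fst z) (fst z) \<le> 0"
        using pos(6) by (simp add: mult_le_0_iff)
      then have W0: "fst z = zero_vf Nx Ny"
        by (rule vinner_h_definite[OF W pos(3,4)])
      have "grad_D Nx Ny hx hy (snd z) = zero_vf Nx Ny"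
        using mom momentum_zero_velocity[of U Nx Ny F, OF U Q, of hx hy \<nu> a] W0
        by (metis prod.collapse)
      then have "snd z = 0\<^sub>m Nx Ny"
        by (rule grad_D_kernel[OF Q pos(3,4) _ mean])
      with W0 show ?thesis by (simp add: prod_eq_iff)
    qed
    show "(g, 0\<^sub>m Nx Ny) \<in> States Nx Ny" using g by simp
  qed
  moreover have "z \<in> States Nx Ny \<and> T z = (g, 0\<^sub>m Nx Ny) \<longleftrightarrow>
      z \<in> unknowns Nx Ny hx hy \<and> momentum Nx Ny hx hy F \<nu> a U z = g
        \<and> div_d Nx Ny hx hy (fst z) = 0\<^sub>m Nx Ny" for z
    using pd_iff[of z] by (auto simp: T_def unknowns_def)
  ultimately show ?thesis by simp
qed

section \<open>The BDF schemes\<close>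

lemma vf_add_right_cancel:
  assumes "X \<in> Vel m n" "Y \<in> Vel m n" "D \<in> Vel m n"
  shows "X + D = Y + D \<longleftrightarrow> X = Y"
  unfolding vf_eq_iff[OF assms(1,2)] vf_eq_iff[OF vf_closed(1)[OF assms(1,3)] vf_closed(1)[OF assms(2,3)]]
  using assms by auto

text \<open>The known part \<open>- D\<close> of the time difference quotient moves to the right-hand side. Matrices of
  unspecified size form no group, so this needs the carrier hypotheses and is checked
  entrywise.\<close>

lemma vf_move_to_right:
  assumes "Y \<in> Vel m n" "L \<in> Vel m n" "B \<in> Vel m n" "G \<in> Vel m n" "D \<in> Vel m n" "g \<in> Vel m n"
  shows "Y - L + B + G = g \<longleftrightarrow> (Y + D) - L + B + G = g + D"
proof -
  have "(Y + D) - L + B + G = (Y - L + B + G) + D"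
    if "Y \<in> carrier_mat m n" "L \<in> carrier_mat m n" "B \<in> carrier_mat m n" "G \<in> carrier_mat m n"
      "D \<in> carrier_mat m n" for Y L B G D :: gfun
    by (rule eq_matI) (simp_all add: that[THEN carrier_matD(1)] that[THEN carrier_matD(2)])
  then have "(Y + D) - L + B + G = (Y - L + B + G) + D"
    using assms by (simp add: prod_eq_iff mem_Times_iff)
  moreover have "Y - L + B + G \<in> Vel m n"
    by (intro vf_closed assms)
  ultimately show ?thesis
    by (simp only: vf_add_right_cancel[OF _ assms(6,5)])
qed

lemma bdf1_quotient_split:
  assumes "W \<in> Vel m n" "U \<in> Vel m n"
  shows "a \<cdot>\<^sub>p (W - U) + a \<cdot>\<^sub>p U = a \<cdot>\<^sub>p W"
proof -
  have "a \<cdot>\<^sub>m (X - Y) + a \<cdot>\<^sub>m Y = a \<cdot>\<^sub>m X"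
    if "X \<in> carrier_mat m n" "Y \<in> carrier_mat m n" for X Y :: gfun
    by (rule eq_matI) (simp_all add: that[THEN carrier_matD(1)] that[THEN carrier_matD(2)]
        right_diff_distrib)
  then show ?thesis using assms by (simp add: smult_vf_def prod_eq_iff mem_Times_iff)
qed

lemma bdf2_quotient_split:
  assumes "W \<in> Vel m n" "U \<in> Vel m n" "U' \<in> Vel m n"
  shows "b \<cdot>\<^sub>p (3 \<cdot>\<^sub>p W - 4 \<cdot>\<^sub>p U + U') + b \<cdot>\<^sub>p (4 \<cdot>\<^sub>p U - U') = (3 * b) \<cdot>\<^sub>p W"
proof -
  have "b \<cdot>\<^sub>m (3 \<cdot>\<^sub>m X - 4 \<cdot>\<^sub>m Y + Z) + b \<cdot>\<^sub>m (4 \<cdot>\<^sub>m Y - Z) = (3 * b) \<cdot>\<^sub>m X"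
    if "X \<in> carrier_mat m n" "Y \<in> carrier_mat m n" "Z \<in> carrier_mat m n" for X Y Z :: gfun
    by (rule eq_matI) (simp_all add: that[THEN carrier_matD(1)] that[THEN carrier_matD(2)]
        right_diff_distrib distrib_left)
  then show ?thesis using assms by (simp add: smult_vf_def prod_eq_iff mem_Times_iff)
qed

lemma bdf1_scheme_iff:
  assumes "U \<in> Vel Nx Ny" "F U \<in> Vel Nx Ny" "f \<in> Vel Nx Ny" "z \<in> States Nx Ny"
  shows "bdf1_scheme Nx Ny hx hy F \<nu> \<tau> f U (fst z) (snd z) \<longleftrightarrow>
    momentum Nx Ny hx hy F \<nu> (1 / \<tau>) U z = f + (1 / \<tau>) \<cdot>\<^sub>p U
    \<and> div_d Nx Ny hx hy (fst z) = 0\<^sub>m Nx Ny"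
proof -
  have W: "fst z \<in> Vel Nx Ny" and Q: "snd z \<in> carrier_mat Nx Ny" using assms by auto
  let ?L = "\<nu> \<cdot>\<^sub>p vlap_h Nx Ny hx hy (fst z)" and ?B = "B_op Nx Ny hx hy F U (fst z)"
  let ?G = "grad_D Nx Ny hx hy (snd z)"
  let ?Y = "(1 / \<tau>) \<cdot>\<^sub>p (fst z - U)" and ?D = "(1 / \<tau>) \<cdot>\<^sub>p U"
  have Y: "?Y \<in> Vel Nx Ny" and D: "?D \<in> Vel Nx Ny"
    by (intro vf_closed W assms)+
  have "?Y - ?L + ?B + ?G = f \<longleftrightarrow> (?Y + ?D) - ?L + ?B + ?G = f + ?D"
    by (rule vf_move_to_right[OF Y vf_closed(3)[OF vlap_h_mem[OF W]]
        B_op_mem[of U Nx Ny F, OF assms(1,2)] grad_D_mem[OF Q] D assms(3)])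
  then show ?thesis
    by (simp only: bdf1_scheme_def momentum_def bdf1_quotient_split[OF W assms(1)])
qed

text \<open>The coefficient of the new velocity is \<open>a = 3 / (2\<tau>)\<close>; the remaining part
  \<open>(- 4 U + U') / (2\<tau>)\<close> of the difference quotient is known.\<close>

lemma bdf2_scheme_iff:
  assumes "U' \<in> Vel Nx Ny" "U \<in> Vel Nx Ny" "F (2 \<cdot>\<^sub>p U - U') \<in> Vel Nx Ny" "f \<in> Vel Nx Ny"
    "z \<in> States Nx Ny"
  shows "bdf2_scheme Nx Ny hx hy F \<nu> \<tau> f U' U (fst z) (snd z) \<longleftrightarrow>
    momentum Nx Ny hx hy F \<nu> (3 / (2 * \<tau>)) (2 \<cdot>\<^sub>p U - U') z = f + (1 / (2 * \<tau>)) \<cdot>\<^sub>p (4 \<cdot>\<^sub>p U - U')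
    \<and> div_d Nx Ny hx hy (fst z) = 0\<^sub>m Nx Ny"
proof -
  have W: "fst z \<in> Vel Nx Ny" and Q: "snd z \<in> carrier_mat Nx Ny" using assms by auto
  let ?L = "\<nu> \<cdot>\<^sub>p vlap_h Nx Ny hx hy (fst z)" and ?E = "2 \<cdot>\<^sub>p U - U'"
  let ?G = "grad_D Nx Ny hx hy (snd z)" and ?b = "1 / (2 * \<tau>)"
  let ?B = "B_op Nx Ny hx hy F ?E (fst z)"
  let ?Y = "?b \<cdot>\<^sub>p (3 \<cdot>\<^sub>p fst z - 4 \<cdot>\<^sub>p U + U')" and ?D = "?b \<cdot>\<^sub>p (4 \<cdot>\<^sub>p U - U')"
  have Y: "?Y \<in> Vel Nx Ny" and E: "?E \<in> Vel Nx Ny" and D: "?D \<in> Vel Nx Ny"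
    by (intro vf_closed W assms)+
  have "?Y - ?L + ?B + ?G = f \<longleftrightarrow> (?Y + ?D) - ?L + ?B + ?G = f + ?D"
    by (rule vf_move_to_right[OF Y vf_closed(3)[OF vlap_h_mem[OF W]]
        B_op_mem[of ?E Nx Ny F, OF E assms(3)] grad_D_mem[OF Q] D assms(4)])
  moreover have "?Y + ?D = (3 / (2 * \<tau>)) \<cdot>\<^sub>p fst z"
    by (simp only: bdf2_quotient_split[OF W assms(2,1)]) simp
  ultimately show ?thesis
    by (simp only: bdf2_scheme_def momentum_def)
qed

lemma unknowns_state: "z \<in> unknowns Nx Ny hx hy \<Longrightarrow> z \<in> States Nx Ny"
  by (auto simp: unknowns_def)

lemma bdf1_uniquely_solvable:
  assumes pos: "0 < Nx" "0 < Ny" "0 < hx" "0 < hy" "0 \<le> \<nu>" "0 < \<tau>"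
    and F: "F \<in> Vel Nx Ny \<rightarrow> Vel Nx Ny" and U: "U \<in> Vel Nx Ny" and f: "f \<in> Vel Nx Ny"
  shows "\<exists>!z. z \<in> unknowns Nx Ny hx hy \<and> bdf1_scheme Nx Ny hx hy F \<nu> \<tau> f U (fst z) (snd z)"
proof -
  have FU: "F U \<in> Vel Nx Ny" by (rule funcset_mem[OF F U])
  have g: "f + (1 / \<tau>) \<cdot>\<^sub>p U \<in> Vel Nx Ny" using f U by (intro vf_closed)
  have a: "0 < 1 / \<tau>" using pos(6) by simp
  have "z \<in> unknowns Nx Ny hx hy \<and> bdf1_scheme Nx Ny hx hy F \<nu> \<tau> f U (fst z) (snd z) \<longleftrightarrow>
    z \<in> unknowns Nx Ny hx hy \<and> momentum Nx Ny hx hy F \<nu> (1 / \<tau>) U z = f + (1 / \<tau>) \<cdot>\<^sub>p U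
      \<and> div_d Nx Ny hx hy (fst z) = 0\<^sub>m Nx Ny" for z
    by (rule conj_cong[OF refl])
      (rule bdf1_scheme_iff[of U Nx Ny F f z, OF U FU f unknowns_state])
  then show ?thesis
    using time_step_uniquely_solvable[of Nx Ny hx hy \<nu> "1 / \<tau>" U F, OF pos(1-5) a U FU g]
    by (simp only:)
qed

lemma bdf2_uniquely_solvable:
  assumes pos: "0 < Nx" "0 < Ny" "0 < hx" "0 < hy" "0 \<le> \<nu>" "0 < \<tau>"
    and F: "F \<in> Vel Nx Ny \<rightarrow> Vel Nx Ny"
    and U: "U' \<in> Vel Nx Ny" "U \<in> Vel Nx Ny" and f: "f \<in> Vel Nx Ny"
  shows "\<exists>!z. z \<in> unknowns Nx Ny hx hy \<and> bdf2_scheme Nx Ny hx hy F \<nu> \<tau> f U' U (fst z) (snd z)"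
proof -
  let ?E = "2 \<cdot>\<^sub>p U - U'" and ?g = "f + (1 / (2 * \<tau>)) \<cdot>\<^sub>p (4 \<cdot>\<^sub>p U - U')"
  have E: "?E \<in> Vel Nx Ny" by (intro vf_closed U)
  have g: "?g \<in> Vel Nx Ny" by (intro vf_closed U f)
  have FE: "F ?E \<in> Vel Nx Ny" by (rule funcset_mem[OF F E])
  have a: "0 < 3 / (2 * \<tau>)" using pos(6) by simp
  have "z \<in> unknowns Nx Ny hx hy \<and> bdf2_scheme Nx Ny hx hy F \<nu> \<tau> f U' U (fst z) (snd z) \<longleftrightarrow>
    z \<in> unknowns Nx Ny hx hy \<and> momentum Nx Ny hx hy F \<nu> (3 / (2 * \<tau>)) ?E z = ?g
      \<and> div_d Nx Ny hx hy (fst z) = 0\<^sub>m Nx Ny" for z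
    by (rule conj_cong[OF refl])
      (rule bdf2_scheme_iff[of U' Nx Ny U F f z, OF U FE f unknowns_state])
  then show ?thesis
    using time_step_uniquely_solvable[of Nx Ny hx hy \<nu> "3 / (2 * \<tau>)" ?E F, OF pos(1-5) a E FE g]
    by (simp only:)
qed

lemma bdf1_computed_mem:
  assumes "bdf1_computed Nx Ny hx hy F \<nu> \<tau> f n U P" "k \<le> n"
  shows "U k \<in> Vel Nx Ny"
  using assms by (cases k) (auto simp: bdf1_computed_def unknowns_def Suc_le_eq)

lemma bdf2_computed_mem:
  assumes c: "bdf2_computed Nx Ny hx hy F \<nu> \<tau> f n U P" and k: "k \<le> n"
  shows "U k \<in> Vel Nx Ny"
proof (cases "k \<le> 1")
  case True
  then show ?thesis using c bdf1_computed_mem[of Nx Ny hx hy F \<nu> \<tau> f 1 U P k]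
    by (simp add: bdf2_computed_def)
next
  case False
  then obtain l where "k = l + 1" "1 \<le> l" "l < n" using k by (cases k) auto
  then show ?thesis using c by (auto simp: bdf2_computed_def unknowns_def)
qed

theorem theorem4p4:
  fixes Nx Ny Nt :: nat and Lx Ly T hx hy \<nu> \<tau> :: real
    and F :: "vfield \<Rightarrow> vfield" and f :: "nat \<Rightarrow> vfield"
  assumes "0 < Nx" and "0 < Ny" and "0 < Nt"
    and "0 < Lx" and "0 < Ly" and "0 < T"
    and "hx = Lx / real Nx" and "hy = Ly / real Ny" and "\<tau> = T / real Nt"
    and "0 < \<nu>" and "0 < \<tau>"
    and "F \<in> Vel Nx Ny \<rightarrow> Vel Nx Ny"
    and "\<And>U. U \<in> Vel Nx Ny \<Longrightarrow> vnorm_h hx hy U \<noteq> 0 \<Longrightarrow> vinner_h hx hy (F U) U \<noteq> 0"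
    and "\<And>n. 1 \<le> n \<Longrightarrow> n \<le> Nt \<Longrightarrow> f n \<in> Vel Nx Ny"
  shows "(\<forall>n U P. n \<le> Nt - 1 \<and> bdf1_computed Nx Ny hx hy F \<nu> \<tau> f n U P \<longrightarrow>
            (\<exists>!WQ. WQ \<in> unknowns Nx Ny hx hy \<and>
              bdf1_scheme Nx Ny hx hy F \<nu> \<tau> (f (n + 1)) (U n) (fst WQ) (snd WQ)))
       \<and> (\<forall>n U P. 1 \<le> n \<and> n \<le> Nt - 1 \<and> bdf2_computed Nx Ny hx hy F \<nu> \<tau> f n U P \<longrightarrow>
            (\<exists>!WQ. WQ \<in> unknowns Nx Ny hx hy \<and>
              bdf2_scheme Nx Ny hx hy F \<nu> \<tau> (f (n + 1)) (U (n - 1)) (U n) (fst WQ) (snd WQ)))"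
proof (intro conjI allI impI)
  have h: "0 < hx" "0 < hy" and \<nu>: "0 \<le> \<nu>" using assms(1-10) by simp_all
  have f: "f (n + 1) \<in> Vel Nx Ny" if "n \<le> Nt - 1" for n
    using assms(3) that by (intro assms(14)) auto
  {
    fix n U P
    assume "n \<le> Nt - 1 \<and> bdf1_computed Nx Ny hx hy F \<nu> \<tau> f n U P"
    then have n: "n \<le> Nt - 1" and c: "bdf1_computed Nx Ny hx hy F \<nu> \<tau> f n U P" by simp_all
    show "\<exists>!WQ. WQ \<in> unknowns Nx Ny hx hy \<and>
        bdf1_scheme Nx Ny hx hy F \<nu> \<tau> (f (n + 1)) (U n) (fst WQ) (snd WQ)"
      by (rule bdf1_uniquely_solvable[OF assms(1,2) h \<nu> assms(11,12)
          bdf1_computed_mem[OF c order_refl] f[OF n]])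
  next
    fix n U P
    assume "1 \<le> n \<and> n \<le> Nt - 1 \<and> bdf2_computed Nx Ny hx hy F \<nu> \<tau> f n U P"
    then have n: "n \<le> Nt - 1" and c: "bdf2_computed Nx Ny hx hy F \<nu> \<tau> f n U P" by simp_all
    show "\<exists>!WQ. WQ \<in> unknowns Nx Ny hx hy \<and>
        bdf2_scheme Nx Ny hx hy F \<nu> \<tau> (f (n + 1)) (U (n - 1)) (U n) (fst WQ) (snd WQ)"
      by (rule bdf2_uniquely_solvable[OF assms(1,2) h \<nu> assms(11,12)
          bdf2_computed_mem[OF c diff_le_self] bdf2_computed_mem[OF c order_refl] f[OF n]])
  }
qed

end
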